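(* Let $n\geq 1$. The map $\phi_G$ is defined on every element of $\mathcal{G}'_{[n]}$ and maps $\mathcal{G}'_{[n]}$ to $\mathcal{D}_{[n]}$, the map $\psi_G$ maps $\mathcal{D}_{[n]}$ to $\mathcal{G}'_{[n]}$, and $\phi_G:\mathcal{G}'_{[n]}\to\mathcal{D}_{[n]}$ and $\psi_G:\mathcal{D}_{[n]}\to\mathcal{G}'_{[n]}$ are bijections (indeed mutually inverse).
   Context: For a finite set $P$ of positive integers with $|P|=n$, a permutation $w$ of $P$ is written as a word $w=w_1\cdots w_n$ with $\{w_1,\dots,w_n\}=P$; $w^*=w_n\cdots w_1$ is its reversal; $w[i,j]=w_i\cdots w_j$ is a (contiguous) subword, proper if $\neq w$; commas denote concatenation. For $|P|\geq 2$, $w$ is a G-word if (G1) $w_1=\max(P)$ and $w_n=\max(P\setminus\{w_1\})$, and (G2) if $n\geq4$ then $w_2>w_{n-1}$; it is a primitive G-word if for every proper subword $x$ of length $\geq 4$, neither $x$ nor $x^*$ is a G-word. For a finite nonempty $P$ with $m=\max(P)$, let $\mathcal{G}'_P$ be the set of permutations $w$ of $P$ such that $(m+2,w,m+1)$ is a primitive G-word (on $P\cup\{m+1,m+2\}$). A decreasing 012-tree on vertex set $P$ is a rooted tree with vertices labeled by the distinct elements of $P$, every vertex having $0$, $1$ or $2$ (unordered) children, with $x<y$ whenever $x$ is a descendant of $y$ (so the root is $\max P$); $\mathcal{D}_P$ is the set of these. Write $[v,T_1,\dots,T_r]$ for the tree with root $v$ whose children root the subtrees $T_1,\dots,T_r$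 (order irrelevant). For a word $w$ on a finite nonempty set $P$ with $m=\max(P)$, $|P|=n$, and $k$ the position of $m$ in $w$, define recursively $\phi_G(w)=[m]$ if $n=1$; $\phi_G(w)=[m,\phi_G(w[2,n])]$ if $n>1$ and $k=1$; $\phi_G(w)=[m,\phi_G(w[1,k-1]^* ),\phi_G(w[k+1,n])]$ if $n>1$ and $2\le k\le n-1$. For $T\in\mathcal{D}_P$ with $m=\max P$, define recursively $\psi_G(T)=m$ if $T$ is the single vertex $m$; $\psi_G([m,T'])=(m,\psi_G(T'))$; and $\psi_G([m,T',T''])=(\psi_G(T')^*,m,\psi_G(T''))$ where $T''$ is the subtree containing $\min(P)$. *)

theory Defs
  imports "HOL-Combinatorics.Combinatorics" "HOL-Library.Sublist" "HOL-Library.FuncSet"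
begin

text \<open>A word is a list of naturals. The underlying set \<open>P\<close> of a word \<open>w\<close> is \<open>set w\<close>,
  and \<open>w\<close> is a permutation of its underlying set iff it is \<^const>\<open>distinct\<close>.
  List indices start at 0, so \<open>w\<^sub>2\<close> is \<open>w ! 1\<close> and \<open>w\<^sub>n\<^sub>-\<^sub>1\<close> is \<open>w ! (n - 2)\<close>.\<close>

definition G_word :: "nat list \<Rightarrow> bool" where
  "G_word w \<longleftrightarrow>
     distinct w \<and> 2 \<le> length w \<and>
     hd w = Max (set w) \<and> last w = Max (set w - {hd w}) \<and>
     (4 \<le> length w \<longrightarrow> w ! (length w - 2) < w ! 1)"

definition primitive_G_word :: "nat list \<Rightarrow> bool" where
  "primitive_G_word w \<longleftrightarrow>
     G_word w \<and>
     (\<forall>x. strict_sublist x w \<and> 4 \<le> length x \<longrightarrow> \<not> G_word x \<and> \<not> G_word (rev x))"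

definition G'_set :: "nat set \<Rightarrow> nat list set" where
  "G'_set P =
     {w \<in> permutations_of_set P. primitive_G_word ((Max P + 2) # w @ [Max P + 1])}"

text \<open>Rooted trees with labelled vertices and unordered children.\<close>

datatype tree = Node nat "tree multiset"

primrec labels :: "tree \<Rightarrow> nat multiset" where
  "labels (Node v ts) = add_mset v (\<Sum>\<^sub># (image_mset labels ts))"

inductive decreasing_012 :: "tree \<Rightarrow> bool" where
  "size ts \<le> 2 \<Longrightarrow>
   (\<forall>t \<in># ts. decreasing_012 t \<and> (\<forall>x \<in># labels t. x < v)) \<Longrightarrow>
   decreasing_012 (Node v ts)"

text \<open>The multiset equation says that every element of \<open>P\<close> labels exactly one vertex.\<close>

definition D_set :: "nat set \<Rightarrow> tree set" where
  "D_set P = {t. decreasing_012 t \<and> labels t = mset_set P}"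

text \<open>The recursion for \<open>\<phi>\<^sub>G\<close> does not cover words of length \<open>n > 1\<close> whose maximum is in
  the last position, so \<open>\<phi>\<^sub>G\<close> is a partial function. The local variable \<open>k\<close> is the
  position of the maximum, counted from 1.\<close>

function phi_G :: "nat list \<Rightarrow> tree option" where
  "phi_G w =
     (if w = [] then None
      else
        let m = Max (set w); n = length w; k = length (takeWhile (\<lambda>x. x \<noteq> m) w) + 1
        in if n = 1 then Some (Node m {#})
           else if k = 1 then
             Option.bind (phi_G (drop 1 w)) (\<lambda>T. Some (Node m {#T#}))
           else if k < n then
             Option.bind (phi_G (rev (take (k - 1) w))) (\<lambda>T'.
             Option.bind (phi_G (drop k w)) (\<lambda>T''. Some (Node m {#T', T''#})))
           else None)"
  by pat_completeness auto
termination by (relation "measure length") auto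

declare phi_G.simps [simp del]

lemma size_mset_member_less: "t \<in># ts \<Longrightarrow> size t < size (Node v ts)"
  by (induction ts) auto

definition min_label :: "tree \<Rightarrow> nat" where
  "min_label t = Min (set_mset (labels t))"

text \<open>In the third equation the order of \<open>T'\<close> and \<open>T''\<close> is determined by where the least label
  occurs, which makes it well-defined on the unordered pair of children. The last equation
  concerns only trees outside every \<open>D_set P\<close>.\<close>

function psi_G :: "tree \<Rightarrow> nat list" where
  "psi_G (Node m {#}) = [m]"
| "psi_G (Node m {#T'#}) = m # psi_G T'"
| "min_label (Node m {#T', T''#}) \<notin># labels T' \<Longrightarrow>
   min_label (Node m {#T', T''#}) \<in># labels T'' \<Longrightarrow>
     psi_G (Node m {#T', T''#}) = rev (psi_G T') @ m # psi_G T''"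
| "ts \<noteq> {#} \<Longrightarrow> (\<forall>T'. ts \<noteq> {#T'#}) \<Longrightarrow>
   (\<forall>T' T''. ts = {#T', T''#} \<longrightarrow>
      min_label (Node m ts) \<in># labels T' \<or> min_label (Node m ts) \<notin># labels T'') \<Longrightarrow>
     psi_G (Node m ts) = undefined"
proof (goal_cases)
  case (1 P x)
  obtain m ts where x: "x = Node m ts" by (cases x)
  show ?case
  proof (cases "ts = {#} \<or> (\<exists>T'. ts = {#T'#}) \<or> (\<exists>T' T''. ts = {#T', T''#} \<and>
      min_label (Node m ts) \<notin># labels T' \<and> min_label (Node m ts) \<in># labels T'')")
    case True
    with 1(1-3) x show ?thesis by metis
  next
    case False
    with 1(4)[of ts m] x show ?thesis by blast
  qed
qed (auto simp: add_eq_conv_ex)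
termination
  by (relation "measure size") (auto intro!: size_mset_member_less simp del: tree.size)

end

theory Submission
  imports Defs
begin

text \<open>Let \<open>w = u, m, v\<close> with \<open>m = max(w)\<close>. A subword of \<open>(m + 2, w, m + 1)\<close> that has \<open>m\<close> strictly
  inside and is a G-word up to reversal must be the whole word, because only \<open>m + 1\<close> and \<open>m + 2\<close>
  exceed \<open>m\<close>; all others lie in \<open>(m + 2, u, m)\<close> or \<open>(m, v, m + 1)\<close>. As the actual values of the
  outer letters are irrelevant except for their comparison with each other, a word \<open>w\<close> of length at
  least 2 belongs to \<open>\<G>'\<close> iff \<open>v\<close> is nonempty, \<open>u\<^sup>*\<close> (if nonempty) and \<open>v\<close> belong to \<open>\<G>'\<close>, and
  \<open>w\<close> starts with a larger letter than it ends with. By induction every word in \<open>\<G>'\<close> ends with its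
  minimum, so for nonempty \<open>u\<close> the last condition says that the minimum lies in \<open>v\<close>, which is the
  rule by which \<open>\<psi>\<^sub>G\<close> orders the two subtrees.\<close>

section \<open>G-words up to reversal, seen through their end letters\<close>

definition G_up_to_rev :: "nat list \<Rightarrow> bool" where
  "G_up_to_rev x \<longleftrightarrow> 4 \<le> length x \<and> (G_word x \<or> G_word (rev x))"

text \<open>This is the part of primitivity that passes to subwords and reversals, separated from
  the demand that \<open>w\<close> itself be a G-word.\<close>

definition no_G_strictly_inside :: "nat list \<Rightarrow> bool" where
  "no_G_strictly_inside w \<longleftrightarrow> (\<forall>x. strict_sublist x w \<longrightarrow> \<not> G_up_to_rev x)"

lemma primitive_G_word_iff: "primitive_G_word w \<longleftrightarrow> G_word w \<and> no_G_strictly_inside w"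
  unfolding primitive_G_word_def no_G_strictly_inside_def G_up_to_rev_def by blast

lemma long_list_framed:
  assumes "2 \<le> length x"
  obtains a u b where "x = a # u @ [b]"
  using assms by (metis Suc_le_length_iff numeral_2_eq_2 rev_exhaust list.distinct(1))

lemma G_word_frame_iff:
  assumes "2 \<le> length u"
  shows "G_word (a # u @ [b]) \<longleftrightarrow>
    distinct (a # u @ [b]) \<and> b < a \<and> (\<forall>x\<in>set u. x < b) \<and> last u < hd u"
proof (cases "distinct (a # u @ [b])")
  case True
  have "u \<noteq> []" using assms by auto
  then have ends: "(a # u @ [b]) ! 1 = hd u" "(a # u @ [b]) ! (length (a # u @ [b]) - 2) = last u"
    using assms by (auto simp: nth_append hd_conv_nth last_conv_nth nth_Cons split: nat.splits)
  have rest: "set (a # u @ [b]) - {a} = insert b (set u)" using True by auto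
  have "a = Max (set (a # u @ [b])) \<longleftrightarrow> b < a \<and> (\<forall>x\<in>set u. x < a)"
    using True by (subst eq_commute, subst Max_eq_iff) (auto simp: le_less)
  moreover have "b = Max (insert b (set u)) \<longleftrightarrow> (\<forall>x\<in>set u. x < b)"
    using True by (subst eq_commute, subst Max_eq_iff) (auto simp: le_less)
  moreover have "last (a # u @ [b]) = b" "hd (a # u @ [b]) = a" by auto
  ultimately show ?thesis
    unfolding G_word_def ends using True rest assms by fastforce
qed (auto simp: G_word_def)

text \<open>Reversal exchanges \<open>a\<close> with \<open>b\<close> and \<open>hd u\<close> with
  \<open>last u\<close>, which yields the two symmetric alternatives.\<close>

lemma G_up_to_rev_iff:
  "G_up_to_rev (a # u @ [b]) \<longleftrightarrow> 2 \<le> length u \<and> distinct (a # u @ [b]) \<and>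
    (\<forall>x\<in>set u. x < a \<and> x < b) \<and> (b < a \<and> last u < hd u \<or> a < b \<and> hd u < last u)"
proof (cases "2 \<le> length u")
  case True
  then have "u \<noteq> []" by auto
  then show ?thesis
    using True G_word_frame_iff[OF True, of a b] G_word_frame_iff[of "rev u" b a]
    by (auto simp: G_up_to_rev_def hd_rev last_rev intro: less_trans)
qed (auto simp: G_up_to_rev_def)

lemma G_up_to_rev_rev [simp]: "G_up_to_rev (rev x) \<longleftrightarrow> G_up_to_rev x"
  by (auto simp: G_up_to_rev_def)

lemma no_G_strictly_inside_rev: "no_G_strictly_inside w \<Longrightarrow> no_G_strictly_inside (rev w)"
  unfolding no_G_strictly_inside_def
  by (metis G_up_to_rev_rev rev_rev_ident strict_sublist_def sublist_rev_left)

text \<open>An end letter enters only through comparisons. The other end letter lies in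
  \<open>p\<close>, so \<open>a\<close> and \<open>a'\<close> both exceed it and the same
  alternative applies to both.\<close>

lemma G_up_to_rev_Cons_iff:
  assumes "\<forall>x\<in>set p. x < a" "\<forall>x\<in>set p. x < a'"
  shows "G_up_to_rev (a # p) \<longleftrightarrow> G_up_to_rev (a' # p)"
proof (cases "p = []")
  case False
  then obtain u c where "p = u @ [c]" by (metis rev_exhaust)
  with assms show ?thesis by (auto simp: G_up_to_rev_iff)
qed (auto simp: G_up_to_rev_def)

lemma G_up_to_rev_snoc_iff:
  assumes "\<forall>x\<in>set s. x < b" "\<forall>x\<in>set s. x < b'"
  shows "G_up_to_rev (s @ [b]) \<longleftrightarrow> G_up_to_rev (s @ [b'])"
  using G_up_to_rev_Cons_iff[of "rev s" b b'] assms
    G_up_to_rev_rev[of "s @ [b]"] G_up_to_rev_rev[of "s @ [b']"] by simp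

section \<open>Proper subwords of a framed word\<close>

lemma strict_sublist_frame_iff:
  "strict_sublist x (a # w @ [b]) \<longleftrightarrow>
    sublist x w \<or> (\<exists>p. prefix p w \<and> x = a # p) \<or> (\<exists>s. suffix s w \<and> x = s @ [b])"
  (is "?L \<longleftrightarrow> ?R")
proof
  assume L: ?L
  then obtain p s where ps: "a # w @ [b] = p @ x @ s"
    by (auto simp: strict_sublist_def sublist_def)
  with L have "p \<noteq> [] \<or> s \<noteq> []" by (auto simp: strict_sublist_def)
  show ?R
  proof (cases p)
    case Nil
    with \<open>p \<noteq> [] \<or> s \<noteq> []\<close> have "s \<noteq> []" by simp
    then obtain s' c where "s = s' @ [c]" by (metis rev_exhaust)
    with ps Nil have *: "a # w = x @ s'" by (metis append.assoc append_Cons append_Nil butlast_snoc)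
    then show ?thesis by (cases x) (auto simp: prefix_def)
  next
    case (Cons q p')
    with ps have w: "w @ [b] = p' @ x @ s" by simp
    show ?thesis
    proof (cases s rule: rev_cases)
      case Nil
      with w show ?thesis by (cases x rule: rev_cases) (auto simp: suffix_def)
    next
      case (snoc s' c)
      with w have "w = p' @ x @ s'" by simp
      then show ?thesis by auto
    qed
  qed
next
  assume ?R
  then have "sublist x (a # w @ [b]) \<and> length x < length (a # w @ [b])"
  proof (elim disjE exE conjE)
    assume "sublist x w"
    then show ?thesis
      using sublist_length_le[of x w] by (auto simp: sublist_def) (metis append_Cons append.assoc)
  next
    fix p assume "prefix p w" "x = a # p"
    then show ?thesis
      by (auto simp: prefix_def sublist_def) (metis append_Nil)
  next
    fix s assume "suffix s w" "x = s @ [b]"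
    then show ?thesis
      by (auto simp: suffix_def sublist_def) (metis append_Cons append_Nil2)
  qed
  then show ?L by (auto simp: strict_sublist_def)
qed

text \<open>No proper subword contains both outer letters, so their mutual order never matters:
  \<open>a < b\<close> is compatible with \<open>b' < a'\<close>.\<close>

lemma no_G_strictly_inside_change_frame:
  assumes "no_G_strictly_inside (a # w @ [b])"
    and "\<forall>x\<in>set w. x < a \<and> x < b" "\<forall>x\<in>set w. x < a' \<and> x < b'"
  shows "no_G_strictly_inside (a' # w @ [b'])"
  unfolding no_G_strictly_inside_def strict_sublist_frame_iff
proof (intro allI impI, elim disjE exE conjE)
  fix x assume "sublist x w"
  then show "\<not> G_up_to_rev x"
    using assms(1) by (auto simp: no_G_strictly_inside_def strict_sublist_frame_iff)
next
  fix x p assume "prefix p w" "x = a' # p"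
  moreover from this have "\<not> G_up_to_rev (a # p)"
    using assms(1) by (auto simp: no_G_strictly_inside_def strict_sublist_frame_iff)
  ultimately show "\<not> G_up_to_rev x"
    using G_up_to_rev_Cons_iff[of p a a'] assms(2,3) by (auto dest: set_mono_prefix)
next
  fix x s assume "suffix s w" "x = s @ [b']"
  moreover from this have "\<not> G_up_to_rev (s @ [b])"
    using assms(1) by (auto simp: no_G_strictly_inside_def strict_sublist_frame_iff)
  ultimately show "\<not> G_up_to_rev x"
    using G_up_to_rev_snoc_iff[of s b b'] assms(2,3) by (auto dest: set_mono_suffix)
qed

lemma no_G_strictly_inside_sublist:
  assumes "sublist x w" "x \<noteq> w" "no_G_strictly_inside w"
  shows "no_G_strictly_inside x \<and> \<not> G_up_to_rev x"
  using assms unfolding no_G_strictly_inside_def strict_sublist_def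
  by (metis sublist_order.dual_order.trans sublist_order.dual_order.antisym)

text \<open>Proper subwords have at most three letters here, too few for
  \<open>G_up_to_rev\<close>.\<close>

lemma no_G_strictly_inside_short:
  assumes "length w \<le> 2"
  shows "no_G_strictly_inside (a # w @ [b])"
  unfolding no_G_strictly_inside_def strict_sublist_frame_iff using assms
  by (auto simp: G_up_to_rev_def dest!: sublist_length_le prefix_length_le suffix_length_le)

section \<open>Cutting a framed word at its inner maximum\<close>

text \<open>The halves share the letter \<open>m\<close> and are themselves proper subwords, so each
  contributes two conditions: one on itself and one on what lies strictly inside it.\<close>

lemma no_G_strictly_inside_split:
  assumes "distinct (a # u @ m # v @ [b])" "m < a" "m < b" "\<forall>x\<in>set u \<union> set v. x < m"
  shows "no_G_strictly_inside (a # u @ m # v @ [b]) \<longleftrightarrow>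
    no_G_strictly_inside (a # u @ [m]) \<and> \<not> G_up_to_rev (a # u @ [m]) \<and>
    no_G_strictly_inside (m # v @ [b]) \<and> \<not> G_up_to_rev (m # v @ [b])" (is "?L \<longleftrightarrow> ?R")
proof
  let ?W = "a # u @ m # v @ [b]"
  have "?W = [] @ (a # u @ [m]) @ v @ [b]" "?W = (a # u) @ (m # v @ [b]) @ []" by auto
  then have "sublist (a # u @ [m]) ?W" "sublist (m # v @ [b]) ?W"
    unfolding sublist_def by blast+
  moreover have "a # u @ [m] \<noteq> ?W" "m # v @ [b] \<noteq> ?W" using assms by auto
  moreover assume ?L
  ultimately show ?R using no_G_strictly_inside_sublist by blast
next
  let ?W = "a # u @ m # v @ [b]"
  assume R: ?R
  show ?L unfolding no_G_strictly_inside_def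
  proof (intro allI impI notI)
    fix x assume x: "strict_sublist x ?W" and G: "G_up_to_rev x"
    have none: "\<not> sublist x (a # u @ [m])" "\<not> sublist x (m # v @ [b])"
      using R G by (auto simp: no_G_strictly_inside_def strict_sublist_def)
    have "2 \<le> length x" using G by (simp add: G_up_to_rev_def)
    then obtain c y d where xy: "x = c # y @ [d]" by (rule long_list_framed)
    have cd: "\<forall>z\<in>set y. z < c \<and> z < d" using G unfolding xy G_up_to_rev_iff by blast
    obtain p s where W: "?W = p @ x @ s"
      using x by (auto simp: strict_sublist_def sublist_def)
    \<comment> \<open>Otherwise \<open>x\<close> lies on one side of \<open>m\<close>, possibly with
      \<open>m\<close> as an end letter, hence within one of the two halves.\<close>
    have "m \<in> set y"
    proof (rule ccontr)
      assume "m \<notin> set y"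
      have "m \<in> set ?W" by simp
      then consider "m \<in> set (p @ [c])" | "m \<in> set (d # s)"
        unfolding W xy using \<open>m \<notin> set y\<close> by auto
      then show False
      proof cases
        case 1
        then obtain p1 p2 where "p @ [c] = p1 @ m # p2" by (meson split_list)
        then have eq: "(a # u) @ m # v @ [b] = p1 @ m # p2 @ y @ d # s"
          using W unfolding xy by (metis append.assoc append_Cons append_Nil)
        \<comment> \<open>As \<open>m\<close> occurs only once in the framed word, the two
          factorizations at \<open>m\<close> coincide.\<close>
        have "m \<notin> set (a # u)" "m \<notin> set (v @ [b])" using assms by auto
        with eq have "p1 = a # u" "v @ [b] = p2 @ y @ d # s"
          by (auto simp: append_Cons_eq_iff simp del: append_Cons)
        moreover have "\<exists>q. m # p2 = q @ [c]"
          using \<open>p @ [c] = p1 @ m # p2\<close>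
          by (metis append_butlast_last_id last_appendR last_snoc list.distinct(1))
        ultimately obtain q where "m # v @ [b] = q @ x @ s" unfolding xy
          by (metis append.assoc append_Cons append_Nil)
        then show False using none(2) by (auto simp: sublist_def)
      next
        case 2
        then obtain s1 s2 where s12: "d # s = s1 @ m # s2" by (meson split_list)
        then have eq: "(a # u) @ m # v @ [b] = (p @ c # y @ s1) @ m # s2"
          using W unfolding xy by (metis append.assoc append_Cons append_Nil)
        have "m \<notin> set (a # u)" "m \<notin> set (v @ [b])" using assms by auto
        with eq have "a # u = p @ c # y @ s1"
          using append_Cons_eq_iff[of m "a # u" "v @ [b]" "p @ c # y @ s1" s2] by blast
        moreover obtain q where "s1 @ [m] = d # q"
          using s12 by (cases s1) auto
        ultimately have "a # u @ [m] = p @ x @ q" unfolding xy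
          by (metis append.assoc append_Cons append_Nil)
        then show False using none(1) by (auto simp: sublist_def)
      qed
    qed
    with cd have "m < c" "m < d" by auto
    moreover have "set ?W = set (p @ x @ s)" by (simp only: W)
    then have "c \<in> set ?W" "d \<in> set ?W" unfolding xy by auto
    moreover have "z \<in> {a, b}" if "z \<in> set ?W" "m < z" for z
      using that assms(4) by (auto dest: less_asym)
    ultimately have "c \<in> {a, b}" "d \<in> {a, b}" by blast+
    have "distinct (p @ x @ s)" using assms(1) by (simp only: W)
    \<comment> \<open>A nonempty \<open>p\<close> uses up the letter \<open>a\<close>, so both ends
      of \<open>x\<close> would be \<open>b\<close>.\<close>
    have "p = []"
    proof (rule ccontr)
      assume "p \<noteq> []"
      then have "hd p = hd ?W" unfolding W by simp
      then have "hd p = a" by simp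
      then have "a \<in> set p" using \<open>p \<noteq> []\<close> by (metis hd_in_set)
      then have "a \<notin> set x" using \<open>distinct (p @ x @ s)\<close> by auto
      then have "c = b" "d = b" using \<open>c \<in> {a, b}\<close> \<open>d \<in> {a, b}\<close> by (auto simp: xy)
      then show False using \<open>distinct (p @ x @ s)\<close> by (simp add: xy)
    qed
    moreover have "s = []"
    proof (rule ccontr)
      assume "s \<noteq> []"
      then have "last s = last ?W" unfolding W by simp
      then have "last s = b" by simp
      then have "b \<in> set s" using \<open>s \<noteq> []\<close> by (metis last_in_set)
      then have "b \<notin> set x" using \<open>distinct (p @ x @ s)\<close> by auto
      then have "c = a" "d = a" using \<open>c \<in> {a, b}\<close> \<open>d \<in> {a, b}\<close> by (auto simp: xy)
      then show False using \<open>distinct (p @ x @ s)\<close> by (simp add: xy)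
    qed
    ultimately show False using W x by (simp add: strict_sublist_def)
  qed
qed

section \<open>Recursive description of the words in \<open>G'_set\<close>\<close>

text \<open>The condition defining \<open>\<G>'\<close>, with \<open>m + 2\<close> and \<open>m + 1\<close> replaced by arbitrary letters exceeding
  those of \<open>w\<close>.\<close>

definition G'_word :: "nat list \<Rightarrow> bool" where
  "G'_word w \<longleftrightarrow> w \<noteq> [] \<and> distinct w \<and> (2 \<le> length w \<longrightarrow> last w < hd w) \<and>
    (\<forall>a b. (\<forall>x\<in>set w. x < a \<and> x < b) \<longrightarrow> no_G_strictly_inside (a # w @ [b]))"

text \<open>By the change of frame, checking a single admissible pair of outer letters
  suffices.\<close>

lemma G'_word_iff_frame:
  assumes "\<forall>x\<in>set w. x < a \<and> x < b"
  shows "G'_word w \<longleftrightarrow> w \<noteq> [] \<and> distinct w \<and> (2 \<le> length w \<longrightarrow> last w < hd w) \<and>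
    no_G_strictly_inside (a # w @ [b])"
  using assms no_G_strictly_inside_change_frame unfolding G'_word_def by blast

lemma G'_word_singleton: "G'_word [m]"
  using no_G_strictly_inside_short[of "[m]"] by (simp add: G'_word_def)

text \<open>The left half reversed is \<open>rev u\<close> framed by \<open>m\<close> and
  \<open>?a\<close>; the right half is \<open>v\<close> framed by \<open>m\<close> and
  \<open>?b\<close>. That neither half satisfies \<open>G_up_to_rev\<close> becomes the comparison
  of last and first letters demanded by \<open>G'_word\<close>.\<close>

lemma G'_word_split:
  assumes "\<forall>x\<in>set u \<union> set v. x < m" "v \<noteq> []"
  shows "G'_word (u @ m # v) \<longleftrightarrow> distinct (u @ v) \<and> G'_word v \<and>
    (u \<noteq> [] \<longrightarrow> G'_word (rev u) \<and> last v < hd u)"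
proof (cases "distinct (u @ v)")
  case True
  let ?a = "Suc (Suc m)" and ?b = "Suc m"
  have notin: "k \<notin> set u \<union> set v" if "m \<le> k" for k
    using assms(1) that by (meson not_less)
  have lt: "\<forall>x\<in>set u \<union> set v. x < m \<and> x < ?a \<and> x < ?b"
    using assms(1) by (auto intro: less_SucI)
  have d: "distinct (?a # u @ m # v @ [?b])" "distinct (u @ m # v)"
    using True notin[of m] notin[of ?a] notin[of ?b] by auto
  \<comment> \<open>This turns the failure of \<open>last u < hd u\<close> into the strict
    inequality \<open>hd u < last u\<close>.\<close>
  have "2 \<le> length u \<Longrightarrow> hd u \<noteq> last u"
    using True by (cases u) auto
  then have fu: "\<not> G_up_to_rev (?a # u @ [m]) \<longleftrightarrow> (2 \<le> length u \<longrightarrow> hd u < last u)"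
    unfolding G_up_to_rev_iff using d lt by auto
  have "2 \<le> length v \<Longrightarrow> hd v \<noteq> last v"
    using True by (cases v) auto
  then have fv: "\<not> G_up_to_rev (m # v @ [?b]) \<longleftrightarrow> (2 \<le> length v \<longrightarrow> last v < hd v)"
    unfolding G_up_to_rev_iff using d lt by auto
  have "no_G_strictly_inside (?a # u @ [m]) \<longleftrightarrow> no_G_strictly_inside (m # rev u @ [?a])"
    using no_G_strictly_inside_rev[of "?a # u @ [m]"]
      no_G_strictly_inside_rev[of "m # rev u @ [?a]"] by auto
  then have Gu: "u \<noteq> [] \<Longrightarrow> no_G_strictly_inside (?a # u @ [m]) \<and> \<not> G_up_to_rev (?a # u @ [m]) \<longleftrightarrow>
      G'_word (rev u)"
    using True lt fu by (subst G'_word_iff_frame[of "rev u" m ?a]) (auto simp: hd_rev last_rev)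
  have Gv: "no_G_strictly_inside (m # v @ [?b]) \<and> \<not> G_up_to_rev (m # v @ [?b]) \<longleftrightarrow> G'_word v"
    using True assms(2) lt fv by (subst G'_word_iff_frame[of v m ?b]) auto
  \<comment> \<open>For empty \<open>u\<close> the first letter is \<open>m\<close>, which exceeds
    \<open>last v\<close>, so no condition remains.\<close>
  have ends: "last (u @ m # v) < hd (u @ m # v) \<longleftrightarrow> (u \<noteq> [] \<longrightarrow> last v < hd u)"
    using assms by (cases u) auto
  have Nil: "no_G_strictly_inside (?a # [] @ [m]) \<and> \<not> G_up_to_rev (?a # [] @ [m])"
    using no_G_strictly_inside_short[of "[]"] by (simp add: G_up_to_rev_def)
  have "G'_word (u @ m # v) \<longleftrightarrow> last (u @ m # v) < hd (u @ m # v) \<and>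
      no_G_strictly_inside (?a # u @ m # v @ [?b])"
    using d lt assms(2) by (subst G'_word_iff_frame[of _ ?a ?b]) (auto simp: Suc_le_eq)
  also have "\<dots> \<longleftrightarrow> (u \<noteq> [] \<longrightarrow> last v < hd u) \<and> G'_word v \<and>
      no_G_strictly_inside (?a # u @ [m]) \<and> \<not> G_up_to_rev (?a # u @ [m])"
    using no_G_strictly_inside_split[OF d(1)] assms ends Gv by auto
  finally show ?thesis using True Gu Nil by (cases "u = []") auto
qed (auto simp: G'_word_def)

text \<open>The letters \<open>Max P + 2\<close> and \<open>Max P + 1\<close> form one admissible
  frame. For it (G1) is automatic, and (G2) becomes the comparison of the ends of \<open>w\<close>,
  void when \<open>w\<close> has a single letter.\<close>

lemma G'_set_eq:
  assumes "finite P" "P \<noteq> {}"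
  shows "G'_set P = {w. G'_word w \<and> set w = P}"
proof -
  have "primitive_G_word ((Max P + 2) # w @ [Max P + 1]) \<longleftrightarrow> G'_word w"
    if w: "set w = P" "distinct w" for w
  proof -
    let ?a = "Max P + 2" and ?b = "Max P + 1"
    have le: "\<forall>x\<in>set w. x \<le> Max P" using w assms by simp
    then have lt: "\<forall>x\<in>set w. x < ?a \<and> x < ?b" by fastforce
    have "w \<noteq> []" using w assms by auto
    have "G_word (?a # w @ [?b]) \<longleftrightarrow> (2 \<le> length w \<longrightarrow> last w < hd w)"
    proof (cases "2 \<le> length w")
      case True
      then show ?thesis using lt w by (auto simp: G_word_frame_iff)
    next
      case False
      with \<open>w \<noteq> []\<close> obtain m where "w = [m]" by (cases w) (auto simp: Suc_le_eq)
      moreover have "m < ?b" using lt \<open>w = [m]\<close> by auto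
      moreover from this have "set [?a, m, ?b] - {?a} = {m, ?b}" by auto
      ultimately show ?thesis by (simp add: G_word_def max_def)
    qed
    then show ?thesis
      using \<open>w \<noteq> []\<close> w by (simp add: primitive_G_word_iff G'_word_iff_frame[OF lt])
  qed
  then show ?thesis
    by (auto simp: G'_set_def permutations_of_set_def G'_word_def)
qed

section \<open>The relation between words and trees\<close>

text \<open>This is the common graph of both maps. In \<open>binary\<close>, \<open>u\<close> is the
  unreversed word of \<open>A\<close>; as related words end in their minimum,
  \<open>last v < last u\<close> says that the least label lies in \<open>B\<close>.\<close>

inductive corresponds :: "nat list \<Rightarrow> tree \<Rightarrow> bool" where
  leaf: "corresponds [m] (Node m {#})"
| unary: "corresponds v T \<Longrightarrow> \<forall>x\<in>set v. x < m \<Longrightarrow> corresponds (m # v) (Node m {#T#})"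
| binary: "corresponds u A \<Longrightarrow> corresponds v B \<Longrightarrow> \<forall>x\<in>set u \<union> set v. x < m \<Longrightarrow>
    distinct (u @ v) \<Longrightarrow> last v < last u \<Longrightarrow>
    corresponds (rev u @ m # v) (Node m {#A, B#})"

lemma corresponds_labels: "corresponds w T \<Longrightarrow> labels T = mset w"
  by (induction rule: corresponds.induct) auto

lemma corresponds_decreasing: "corresponds w T \<Longrightarrow> decreasing_012 T"
proof (induction rule: corresponds.induct)
  case (unary v T m)
  then show ?case by (auto intro!: decreasing_012.intros simp: corresponds_labels)
next
  case (binary u A v B m)
  then show ?case by (auto intro!: decreasing_012.intros simp: corresponds_labels)
qed (auto intro: decreasing_012.intros)

lemma corresponds_nonempty: "corresponds w T \<Longrightarrow> w \<noteq> []"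
  by (induction rule: corresponds.induct) auto

lemma corresponds_G'_word: "corresponds w T \<Longrightarrow> G'_word w"
proof (induction rule: corresponds.induct)
  case (leaf m)
  show ?case by (rule G'_word_singleton)
next
  case (unary v T m)
  then show ?case using G'_word_split[of "[]" v m] by (auto simp: G'_word_def)
next
  case (binary u A v B m)
  then show ?case
    using G'_word_split[of "rev u" v m] corresponds_nonempty by (auto simp: hd_rev)
qed

text \<open>In \<open>binary\<close>, \<open>last v\<close> bounds \<open>v\<close> by induction,
  and it bounds \<open>u\<close> because it is below \<open>last u\<close>, the least letter of
  \<open>u\<close>.\<close>

lemma corresponds_last_least:
  "corresponds w T \<Longrightarrow> x \<in> set w \<Longrightarrow> last w \<le> x"
proof (induction arbitrary: x rule: corresponds.induct)
  case (unary v T m)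
  then show ?case using corresponds_nonempty[OF unary(1)]
    by (auto intro: less_imp_le)
next
  case (binary u A v B m)
  have "last v < m" using binary corresponds_nonempty by simp
  then show ?case using binary corresponds_nonempty[OF binary(2)]
    by (auto intro: less_imp_le) (meson less_imp_le order.trans)
qed auto

lemma corresponds_phi_G: "corresponds w T \<Longrightarrow> phi_G w = Some T"
proof (induction rule: corresponds.induct)
  case (leaf m)
  show ?case by (subst phi_G.simps) simp
next
  case (unary v T m)
  have "Max (set (m # v)) = m"
    using unary by (intro Max_eqI) (auto intro: less_imp_le)
  then show ?case
    using unary corresponds_nonempty[OF unary(1)] by (subst phi_G.simps) (simp add: Let_def)
next
  case (binary u A v B m)
  have ne: "u \<noteq> []" "v \<noteq> []" using binary corresponds_nonempty by auto
  have "Max (set (rev u @ m # v)) = m"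
    using binary by (intro Max_eqI) (auto intro: less_imp_le)
  \<comment> \<open>The prefix before \<open>m\<close> is \<open>rev u\<close>, which
    \<open>phi_G\<close> reverses back to \<open>u\<close>.\<close>
  moreover have "takeWhile (\<lambda>x. x \<noteq> m) (rev u @ m # v) = rev u"
    using binary by (subst takeWhile_append2) auto
  ultimately show ?case
    using binary ne by (subst phi_G.simps) (simp add: Let_def)
qed

lemma corresponds_psi_G: "corresponds w T \<Longrightarrow> psi_G T = w"
proof (induction rule: corresponds.induct)
  case (binary u A v B m)
  note ne = corresponds_nonempty[OF binary(1)] corresponds_nonempty[OF binary(2)]
  have "corresponds (rev u @ m # v) (Node m {#A, B#})" using binary corresponds.binary by blast
  \<comment> \<open>The word ends in its minimum, so the least label belongs to \<open>B\<close> and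
    the third equation of \<open>psi_G\<close> applies.\<close>
  from corresponds_last_least[OF this] corresponds_labels[OF this]
  have "min_label (Node m {#A, B#}) = last v"
    unfolding min_label_def using ne by (intro Min_eqI) (auto simp del: labels.simps)
  moreover have "last v \<in> set v" using ne by simp
  moreover from this have "last v \<notin> set u" using binary by auto
  ultimately show ?case using binary by (simp add: corresponds_labels)
qed auto

section \<open>Every word and every tree has a partner\<close>

text \<open>The induction is on length because the recursion reverses the prefix before the
  maximum.\<close>

lemma G'_word_corresponds: "G'_word w \<Longrightarrow> \<exists>T. corresponds w T"
proof (induction w rule: length_induct)
  case (1 w)
  then have w: "w \<noteq> []" "distinct w" by (auto simp: G'_word_def)
  define m where "m = Max (set w)"
  have "m \<in> set w" using w by (simp add: m_def)
  then obtain u v where uv: "w = u @ m # v" by (meson split_list)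
  have "\<forall>x\<in>set w. x \<le> m" by (simp add: m_def)
  then have lt: "\<forall>x\<in>set u \<union> set v. x < m" using w uv by (auto simp: le_less)
  show ?case
  proof (cases "v = []")
    case True
    \<comment> \<open>This rules out the case in which \<open>phi_G\<close> is undefined: a final
      \<open>m\<close> cannot be smaller than the first letter.\<close>
    have "u = []"
    proof (rule ccontr)
      assume "u \<noteq> []"
      then have "2 \<le> length w" "last w = m" "hd w \<in> set u"
        using uv True by (auto simp: Suc_le_eq)
      moreover from this have "last w < hd w" using 1(2) by (simp add: G'_word_def)
      moreover have "hd w < m" using lt \<open>hd w \<in> set u\<close> by blast
      ultimately show False by simp
    qed
    with uv True show ?thesis using corresponds.leaf by auto
  next
    case False
    note split = G'_word_split[OF lt False, folded uv]
    then have "G'_word v" using 1(2) by blast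
    moreover have "length v < length w" using uv by simp
    ultimately obtain B where B: "corresponds v B" using 1(1) by blast
    show ?thesis
    proof (cases "u = []")
      case True
      then show ?thesis using corresponds.unary[OF B, of m] lt uv by auto
    next
      case u: False
      with split 1(2) have u': "G'_word (rev u)" "last v < hd u" by auto
      moreover have "length (rev u) < length w" using uv by simp
      ultimately obtain A where "corresponds (rev u) A" using 1(1) by blast
      from corresponds.binary[OF this B, of m] show ?thesis
        using u u' lt uv w by (auto simp: last_rev)
    qed
  qed
qed

text \<open>Distinctness of labels is expressed by multiplicities, which do not increase on passing
  to a subtree.\<close>

lemma decreasing_012_corresponds:
  "decreasing_012 T \<Longrightarrow> \<forall>x. count (labels T) x \<le> 1 \<Longrightarrow> \<exists>w. corresponds w T"
proof (induction rule: decreasing_012.induct)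
  case (1 ts v)
  have IH: "\<exists>w. corresponds w t" if "t \<in># ts" for t
  proof -
    from that obtain us where "ts = add_mset t us" by (meson multi_member_split)
    then have "count (labels t) x \<le> count (labels (Node v ts)) x" for x by simp
    then have "\<forall>x. count (labels t) x \<le> 1" using 1(3) order.trans by blast
    then show ?thesis using 1(2) that by blast
  qed
  have lt: "\<forall>x\<in>set w. x < v" if "t \<in># ts" "corresponds w t" for t w
    using 1(2) that corresponds_labels by fastforce
  consider "ts = {#}" | A where "ts = {#A#}" | A B where "ts = {#A, B#}"
  proof -
    have "size ts = 0 \<or> size ts = 1 \<or> size ts = Suc 1" using 1(1) by linarith
    then show ?thesis using that
      by (metis size_eq_Suc_imp_eq_union size_1_singleton_mset size_eq_0_iff_empty
          add_mset_eq_singleton_iff diff_Suc_1 size_add_mset)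
  qed
  then show ?case
  proof cases
    case 1
    then show ?thesis using corresponds.leaf by blast
  next
    case 2
    then show ?thesis using IH lt corresponds.unary
      by (metis union_single_eq_member)
  next
    case (3 A B)
    then obtain a b where ab: "corresponds a A" "corresponds b B"
      using IH[of A] IH[of B] by auto
    with 3 lt have lts: "\<forall>x\<in>set a \<union> set b. x < v" by auto
    have "count (mset (a @ b)) x \<le> 1" for x
    proof -
      have "count (mset (a @ b)) x \<le> count (labels (Node v ts)) x"
        using 3 ab by (simp add: corresponds_labels)
      then show ?thesis
        using \<open>\<forall>x. count (labels (Node v ts)) x \<le> 1\<close> order.trans by blast
    qed
    then have d: "distinct (a @ b)"
      by (metis count_greater_eq_one_iff distinct_count_atmost_1 le_antisym not_in_iff set_mset_mset)
    have ne: "a \<noteq> []" "b \<noteq> []" using ab corresponds_nonempty by auto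
    then have "last a \<in> set a" "last b \<in> set b" by auto
    then have "last a \<noteq> last b" using d by auto
    \<comment> \<open>The last letters are the minima of the two subtrees. They decide which child
      takes the role of \<open>B\<close>; both orders give the same multiset.\<close>
    then consider "last b < last a" | "last a < last b" by linarith
    then show ?thesis
    proof cases
      case 1
      then show ?thesis using corresponds.binary[OF ab lts d] 3 by blast
    next
      case 2
      then show ?thesis using corresponds.binary[OF ab(2,1), of v] lts d 3
        by (auto simp: add_mset_commute)
    qed
  qed
qed

theorem theorem8:
  fixes n :: nat
  assumes "n \<ge> 1"
  shows "(\<forall>w \<in> G'_set {1..n}. phi_G w \<noteq> None) \<and>
         (\<lambda>w. the (phi_G w)) \<in> G'_set {1..n} \<rightarrow> D_set {1..n} \<and>
         psi_G \<in> D_set {1..n} \<rightarrow> G'_set {1..n} \<and>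
         bij_betw (\<lambda>w. the (phi_G w)) (G'_set {1..n}) (D_set {1..n}) \<and>
         bij_betw psi_G (D_set {1..n}) (G'_set {1..n}) \<and>
         (\<forall>w \<in> G'_set {1..n}. psi_G (the (phi_G w)) = w) \<and>
         (\<forall>T \<in> D_set {1..n}. the (phi_G (psi_G T)) = T)"
proof -
  let ?P = "{1..n}"
  have G: "G'_set ?P = {w. G'_word w \<and> set w = ?P}"
    using assms by (intro G'_set_eq) auto
  have phi: "phi_G w \<noteq> None \<and> the (phi_G w) \<in> D_set ?P \<and> psi_G (the (phi_G w)) = w"
    if w: "w \<in> G'_set ?P" for w
  proof -
    \<comment> \<open>A related tree determines both values: \<open>phi_G w = Some T\<close> and
      \<open>psi_G T = w\<close>.\<close>
    from w obtain T where T: "corresponds w T" unfolding G using G'_word_corresponds by blast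
    have "mset w = mset_set ?P"
      using w unfolding G G'_word_def by (metis (mono_tags, lifting) mem_Collect_eq mset_set_set)
    with T show ?thesis
      by (auto simp: D_set_def corresponds_phi_G corresponds_psi_G corresponds_decreasing
          corresponds_labels)
  qed
  have psi: "psi_G T \<in> G'_set ?P \<and> the (phi_G (psi_G T)) = T" if T: "T \<in> D_set ?P" for T
  proof -
    have "\<forall>x. count (labels T) x \<le> 1" using T by (auto simp: D_set_def count_mset_set')
    then obtain w where w: "corresponds w T"
      using T decreasing_012_corresponds unfolding D_set_def by blast
    have "mset w = mset_set ?P" using T corresponds_labels[OF w] by (simp add: D_set_def)
    then have "set w = ?P" by (metis finite_atLeastAtMost finite_set_mset_mset_set set_mset_mset)
    with w show ?thesis
      unfolding G by (simp add: corresponds_phi_G corresponds_psi_G corresponds_G'_word)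
  qed
  have "bij_betw (\<lambda>w. the (phi_G w)) (G'_set ?P) (D_set ?P)"
    using phi psi by (intro bij_betw_byWitness[where f' = psi_G]) auto
  moreover have "bij_betw psi_G (D_set ?P) (G'_set ?P)"
    using phi psi by (intro bij_betw_byWitness[where f' = "\<lambda>w. the (phi_G w)"]) auto
  ultimately show ?thesis using phi psi by auto
qed

end
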